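(* Let $G$ be a finite group. (1) The relations $\equiv_{\mathrm m}^{(r)}$ on $G$ get finer as $r$ increases. (2) The smallest value of $r$ for which $\equiv_{\mathrm m}^{(r)}$ is not the universal relation is $d(G)$. For $r=d(G)$, there are at least $r+1$ equivalence classes of $\equiv_{\mathrm m}^{(r)}$. (3) The limit value of this sequence of relations is $\equiv_{\mathrm m}$.
   Context: For a finite group $G$, $d(G)$ denotes the minimum number of generators of $G$. For $x,y\in G$, $x\equiv_{\mathrm m} y$ means that $x$ and $y$ lie in exactly the same maximal subgroups of $G$. For any positive integer $r$, $x\equiv_{\mathrm m}^{(r)}y$ means that for all $z_1,\ldots,z_{r-1}\in G$ one has $\langle x,z_1,\ldots,z_{r-1}\rangle=G$ if and only if $\langle y,z_1,\ldots,z_{r-1}\rangle=G$.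
   Formalization: Part (2) is stated for nontrivial G only: for the trivial group d(G) = 0, every relation with r ≥ 1 is universal, so no smallest r exists, and the relation for r = d(G) = 0 is not defined. Parts (1) and (3) cover all finite groups. *)

theory Defs
  imports "HOL-Algebra.Elementary_Groups"
begin

definition min_num_gens :: "('a, 'b) monoid_scheme \<Rightarrow> nat" where
  "min_num_gens G =
     (LEAST n. \<exists>S. S \<subseteq> carrier G \<and> finite S \<and> card S = n \<and> generate G S = carrier G)"

definition maximal_subgroup :: "'a set \<Rightarrow> ('a, 'b) monoid_scheme \<Rightarrow> bool" where
  "maximal_subgroup M G \<longleftrightarrow>
     subgroup M G \<and> M \<noteq> carrier G \<and>
     (\<forall>H. subgroup H G \<and> M \<subseteq> H \<longrightarrow> H = M \<or> H = carrier G)"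

definition m_equiv :: "('a, 'b) monoid_scheme \<Rightarrow> ('a \<times> 'a) set" where
  "m_equiv G =
     {(x, y). x \<in> carrier G \<and> y \<in> carrier G \<and>
        (\<forall>M. maximal_subgroup M G \<longrightarrow> (x \<in> M \<longleftrightarrow> y \<in> M))}"

(* The tuple z_1, ..., z_(r-1) is a list, so repetitions are allowed.  Only r \<ge> 1 is
   meaningful: r - 1 is truncated subtraction, so the value at r = 0 is an artefact. *)
definition mr_equiv :: "nat \<Rightarrow> ('a, 'b) monoid_scheme \<Rightarrow> ('a \<times> 'a) set" where
  "mr_equiv r G =
     {(x, y). x \<in> carrier G \<and> y \<in> carrier G \<and>
        (\<forall>zs. length zs = r - 1 \<and> set zs \<subseteq> carrier G \<longrightarrow>
           (generate G (insert x (set zs)) = carrier G \<longleftrightarrow>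
            generate G (insert y (set zs)) = carrier G))}"

lemma equiv_m_equiv: "equiv (carrier G) (m_equiv G)"
  by (rule equivI) (auto simp: m_equiv_def intro!: refl_onI symI transI)

lemma equiv_mr_equiv: "equiv (carrier G) (mr_equiv r G)"
  by (rule equivI) (auto simp: mr_equiv_def intro!: refl_onI symI transI)

end

theory Submission
  imports Defs
begin

text \<open>
  Padding a tuple with the identity does not change the subgroup it generates, so in the definition
  of \<open>mr_equiv r G\<close> the tuples may be replaced by sets of at most \<open>r - 1\<close> elements; monotonicity in
  \<open>r\<close> is then immediate. A minimum generating set together with the identity consists of pairwise
  inequivalent elements: replacing one generator by another of these elements leaves a subgroup
  generated by fewer than \<open>d(G)\<close> elements. For the limit, every proper subgroup lies in a maximal
  one, and a maximal subgroup \<open>M\<close> can itself serve as the auxiliary set once \<open>r > |G|\<close>.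
\<close>

section \<open>Tuples replaced by bounded finite sets\<close>

lemma (in group) generate_insert_absorb:
  assumes "A \<subseteq> carrier G" "x \<in> generate G A"
  shows "generate G (insert x A) = generate G A"
proof
  show "generate G (insert x A) \<subseteq> generate G A"
    using assms by (intro generate_subgroup_incl generate_is_subgroup) (auto intro: generate.incl)
qed (auto intro: mono_generate[THEN subsetD])

text \<open>The identity is a harmless filler: a set with at most \<open>r - 1\<close> elements
  becomes a tuple of length exactly \<open>r - 1\<close>. Since the exact length turns into an upper
  bound, later arguments can choose test sets without padding.\<close>

lemma (in group) mr_equiv_iff:
  "(x, y) \<in> mr_equiv r G \<longleftrightarrow> x \<in> carrier G \<and> y \<in> carrier G \<and>
     (\<forall>A. A \<subseteq> carrier G \<and> finite A \<and> card A \<le> r - 1 \<longrightarrow>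
        (generate G (insert x A) = carrier G \<longleftrightarrow> generate G (insert y A) = carrier G))"
  (is "_ \<longleftrightarrow> ?R")
proof
  assume xy: "(x, y) \<in> mr_equiv r G"
  then have x: "x \<in> carrier G" and y: "y \<in> carrier G"
    by (auto simp: mr_equiv_def)
  have "generate G (insert x A) = carrier G \<longleftrightarrow> generate G (insert y A) = carrier G"
    if A: "A \<subseteq> carrier G" "finite A" "card A \<le> r - 1" for A
  proof -
    obtain as where as: "set as = A" "length as = card A"
      using A(2) finite_distinct_list distinct_card by metis
    \<comment> \<open>Since \<open>card A \<le> r - 1\<close>, the outer subtraction does not
      truncate and the length comes out exactly.\<close>
    define zs where "zs = as @ replicate (r - 1 - card A) \<one>"
    have zs: "length zs = r - 1" "set zs \<subseteq> carrier G" "A \<subseteq> set zs" "set zs \<subseteq> insert \<one> A"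
      using as A by (auto simp: zs_def)
    have "generate G (insert u (set zs)) = generate G (insert u A)" if u: "u \<in> carrier G" for u
    proof
      have "generate G (insert u (set zs)) \<subseteq> generate G (insert \<one> (insert u A))"
        using zs by (intro mono_generate) auto
      also have "\<dots> = generate G (insert u A)"
        using u A by (intro generate_insert_absorb generate.one) auto
      finally show "generate G (insert u (set zs)) \<subseteq> generate G (insert u A)" .
      show "generate G (insert u A) \<subseteq> generate G (insert u (set zs))"
        using zs by (intro mono_generate) auto
    qed
    then show ?thesis
      using xy x y zs by (auto simp: mr_equiv_def)
  qed
  with x y show ?R by blast
next
  assume ?R
  then show "(x, y) \<in> mr_equiv r G"
    \<comment> \<open>Entries of a tuple may repeat, so its entry set has at most
      \<open>r - 1\<close> elements.\<close>
    by (auto simp: mr_equiv_def) (metis card_length List.finite_set)+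
qed

lemma (in group) mr_equiv_antimono: "r \<le> s \<Longrightarrow> mr_equiv s G \<subseteq> mr_equiv r G"
  using diff_le_mono[of r s 1] by (auto simp: mr_equiv_iff dest: order_trans)

section \<open>Minimum generating sets and the value r = d(G)\<close>

lemma min_num_gens_le:
  assumes "S \<subseteq> carrier G" "finite S" "generate G S = carrier G"
  shows "min_num_gens G \<le> card S"
  unfolding min_num_gens_def using assms by (intro Least_le) blast

lemma (in group) obtain_min_generating_set:
  assumes "finite (carrier G)"
  obtains S where "S \<subseteq> carrier G" "finite S" "card S = min_num_gens G" "generate G S = carrier G"
proof -
  \<comment> \<open>The whole carrier is a finite generating set, so the \<open>LEAST\<close> in
    \<open>min_num_gens\<close> is attained.\<close>
  have "generate G (carrier G) = carrier G"
    using generate_in_carrier[of "carrier G"] by (auto intro: generate.incl)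
  then have "\<exists>n S. S \<subseteq> carrier G \<and> finite S \<and> card S = n \<and> generate G S = carrier G"
    using assms by blast
  from LeastI_ex[OF this] show thesis
    using that unfolding min_num_gens_def by blast
qed

text \<open>The element \<open>y\<close> is the identity or survives in \<open>S - {x}\<close>, so
  inserting it adds nothing to the subgroup generated by \<open>S - {x}\<close>, a set too small to
  generate \<open>G\<close>.\<close>

lemma (in group) exchange_not_generating:
  assumes S: "S \<subseteq> carrier G" "finite S" "card S = min_num_gens G"
    and x: "x \<in> S" and y: "y \<in> insert \<one> S" "y \<noteq> x"
  shows "generate G (insert y (S - {x})) \<noteq> carrier G"
proof -
  have "y \<in> generate G (S - {x})"
    using y by (auto intro: generate.intros)
  then have "generate G (insert y (S - {x})) = generate G (S - {x})"
    using S(1) by (intro generate_insert_absorb) auto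
  moreover have "generate G (S - {x}) \<noteq> carrier G"
    using min_num_gens_le[of "S - {x}" G] card_Diff1_less[OF S(2) x] S by fastforce
  ultimately show ?thesis by simp
qed

text \<open>The set \<open>S - {x}\<close> separates the two elements: \<open>x\<close> completes it
  to \<open>S\<close>, while \<open>y\<close> does not make it generate. Only \<open>y\<close> may
  be the identity here.\<close>

lemma (in group) min_generating_set_inequivalent:
  assumes S: "S \<subseteq> carrier G" "finite S" "card S = min_num_gens G" "generate G S = carrier G"
    and x: "x \<in> S" and y: "y \<in> insert \<one> S" "y \<noteq> x"
  shows "(x, y) \<notin> mr_equiv (min_num_gens G) G"
proof
  assume "(x, y) \<in> mr_equiv (min_num_gens G) G"
  moreover have "S - {x} \<subseteq> carrier G" "finite (S - {x})" "card (S - {x}) \<le> min_num_gens G - 1"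
    using S x by auto
  ultimately have "generate G (insert x (S - {x})) = carrier G
      \<longleftrightarrow> generate G (insert y (S - {x})) = carrier G"
    unfolding mr_equiv_iff by blast
  then show False
    using exchange_not_generating[OF S(1-3) x y] S(4) x by (simp add: insert_absorb)
qed

text \<open>Dropping the identity would give a smaller generating set. This makes
  \<open>insert \<one> S\<close> have d(G) + 1 elements, the source of the extra class.\<close>

lemma (in group) one_notin_min_generating_set:
  assumes "S \<subseteq> carrier G" "finite S" "card S = min_num_gens G" "generate G S = carrier G"
  shows "\<one> \<notin> S"
proof
  assume one: "\<one> \<in> S"
  have "generate G (insert \<one> (S - {\<one>})) = generate G (S - {\<one>})"
    using assms by (intro generate_insert_absorb generate.one) auto
  then have "min_num_gens G \<le> card (S - {\<one>})"
    using assms one by (intro min_num_gens_le) (auto simp: insert_absorb)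
  then show False
    using card_Diff1_less[OF assms(2) one] assms(3) by simp
qed

lemma (in group) min_num_gens_pos:
  assumes "finite (carrier G)" "\<not> trivial_group G"
  shows "1 \<le> min_num_gens G"
proof -
  obtain S where S: "finite S" "card S = min_num_gens G" "generate G S = carrier G"
    using obtain_min_generating_set[OF assms(1)] .
  have "S \<noteq> {}"
    using S(3) assms(2) generate_empty group_axioms by (auto simp: trivial_group_def)
  then show ?thesis
    using S by (metis One_nat_def Suc_leI card_gt_0_iff)
qed

lemma (in group) card_classes_min_num_gens:
  assumes "finite (carrier G)"
  shows "min_num_gens G + 1 \<le> card (carrier G // mr_equiv (min_num_gens G) G)"
proof -
  let ?R = "mr_equiv (min_num_gens G) G"
  obtain S where S: "S \<subseteq> carrier G" "finite S" "card S = min_num_gens G" "generate G S = carrier G"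
    using obtain_min_generating_set[OF assms] .
  note R = equiv_mr_equiv[of G "min_num_gens G"]
  \<comment> \<open>Of two distinct such elements at least one lies in \<open>S\<close>; symmetry of
    the relation allows it to be put first.\<close>
  have "u = v" if "u \<in> insert \<one> S" "v \<in> insert \<one> S" "(u, v) \<in> ?R" for u v
    using that min_generating_set_inequivalent[OF S] equivE[OF R] by (metis insertE symE)
  then have "inj_on (\<lambda>u. ?R `` {u}) (insert \<one> S)"
    using eq_equiv_class_iff[OF R] S(1) by (intro inj_onI) (metis insert_subset one_closed subsetD)
  moreover have "(\<lambda>u. ?R `` {u}) ` insert \<one> S \<subseteq> carrier G // ?R"
    using S(1) by (auto intro: quotientI)
  moreover have "finite (carrier G // ?R)"
    using assms by (simp add: quotient_def)
  ultimately have "card (insert \<one> S) \<le> card (carrier G // ?R)"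
    by (metis card_inj_on_le)
  then show ?thesis
    using one_notin_min_generating_set[OF S] S by simp
qed

lemma (in group) mr_equiv_min_num_gens_not_universal:
  assumes "finite (carrier G)" "\<not> trivial_group G"
  shows "mr_equiv (min_num_gens G) G \<noteq> carrier G \<times> carrier G"
proof -
  obtain S where S: "S \<subseteq> carrier G" "finite S" "card S = min_num_gens G" "generate G S = carrier G"
    using obtain_min_generating_set[OF assms(1)] .
  obtain x where "x \<in> S"
    using min_num_gens_pos[OF assms] S by fastforce
  moreover have "\<one> \<noteq> x"
    using \<open>x \<in> S\<close> one_notin_min_generating_set[OF S] by blast
  ultimately have "(x, \<one>) \<notin> mr_equiv (min_num_gens G) G"
    using min_generating_set_inequivalent[OF S] by blast
  then show ?thesis
    using \<open>x \<in> S\<close> S(1) by blast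
qed

text \<open>Below d(G) the defining equivalence holds because both of its sides are false: each has
  fewer than d(G) generators.\<close>

lemma (in group) mr_equiv_universal:
  assumes "1 \<le> r" "r < min_num_gens G"
  shows "mr_equiv r G = carrier G \<times> carrier G"
proof -
  have "generate G (insert x A) \<noteq> carrier G"
    if "x \<in> carrier G" "A \<subseteq> carrier G" "finite A" "card A \<le> r - 1" for x A
    \<comment> \<open>The bound \<open>card (insert x A) \<le> r\<close> relies on
      \<open>1 \<le> r\<close>, where \<open>r - 1\<close> is a true predecessor.\<close>
    using that assms min_num_gens_le[of "insert x A" G] card_insert_le_m1[of r A x] by fastforce
  then show ?thesis
    by (auto simp: mr_equiv_iff)
qed

section \<open>Maximal subgroups and the limit relation\<close>

lemma (in group) subgroup_in_maximal_subgroup: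
  assumes "finite (carrier G)" "subgroup H G" "H \<noteq> carrier G"
  obtains M where "maximal_subgroup M G" "H \<subseteq> M"
proof -
  let ?P = "{K. subgroup K G \<and> K \<noteq> carrier G}"
  have "finite ?P"
    by (rule finite_subset[of _ "Pow (carrier G)"]) (use assms(1) subgroup.subset in auto)
  then obtain M where "M \<in> ?P" "H \<subseteq> M" "\<forall>K\<in>?P. M \<subseteq> K \<longrightarrow> M = K"
    using finite_has_maximal2[of ?P H] assms by blast
  then show thesis
    by (intro that[of M]) (auto simp: maximal_subgroup_def)
qed

lemma m_equiv_sym: "(x, y) \<in> m_equiv G \<Longrightarrow> (y, x) \<in> m_equiv G"
  by (auto simp: m_equiv_def)

text \<open>Failure to generate is witnessed by a maximal subgroup containing \<open>y\<close> and
  \<open>A\<close>; it then contains \<open>x\<close> as well. The size of \<open>A\<close> is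
  unrestricted, so this serves every \<open>r\<close>.\<close>

lemma (in group) m_equiv_generate:
  assumes "finite (carrier G)" "(x, y) \<in> m_equiv G" "A \<subseteq> carrier G"
    and gen: "generate G (insert x A) = carrier G"
  shows "generate G (insert y A) = carrier G"
proof (rule ccontr)
  assume "generate G (insert y A) \<noteq> carrier G"
  moreover have "y \<in> carrier G"
    using assms(2) by (simp add: m_equiv_def)
  ultimately obtain M where M: "maximal_subgroup M G" "generate G (insert y A) \<subseteq> M"
    using subgroup_in_maximal_subgroup[OF assms(1)] generate_is_subgroup assms(3)
    by (metis insert_subset)
  have "insert y A \<subseteq> M"
    using M(2) generate.incl by (metis subset_iff)
  then have "insert x A \<subseteq> M"
    using assms(2) M(1) by (auto simp: m_equiv_def)
  then have "carrier G \<subseteq> M"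
    using gen generate_subgroup_incl M(1) by (metis maximal_subgroup_def)
  then show False
    using M(1) by (auto simp: maximal_subgroup_def dest: subgroup.subset)
qed

lemma (in group) m_equiv_subset_mr_equiv:
  assumes "finite (carrier G)"
  shows "m_equiv G \<subseteq> mr_equiv r G"
proof safe
  fix x y assume xy: "(x, y) \<in> m_equiv G"
  then show "(x, y) \<in> mr_equiv r G"
    using m_equiv_generate[OF assms xy] m_equiv_generate[OF assms m_equiv_sym[OF xy]]
    unfolding mr_equiv_iff by (auto simp: m_equiv_def)
qed

text \<open>An element outside \<open>M\<close> strictly enlarges it, and maximality leaves only
  \<open>G\<close>. Membership in \<open>M\<close> thus becomes a generation test with auxiliary set
  \<open>M\<close>.\<close>

lemma (in group) generate_insert_maximal_subgroup:
  assumes "maximal_subgroup M G" "x \<in> carrier G"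
  shows "generate G (insert x M) = carrier G \<longleftrightarrow> x \<notin> M"
proof -
  have M: "subgroup M G" "M \<noteq> carrier G"
    using assms by (auto simp: maximal_subgroup_def)
  have sub: "subgroup (generate G (insert x M)) G"
    using assms(2) subgroup.subset[OF M(1)] by (intro generate_is_subgroup) auto
  have incl: "insert x M \<subseteq> generate G (insert x M)"
    by (auto intro: generate.incl)
  show ?thesis
  proof
    assume gen: "generate G (insert x M) = carrier G"
    show "x \<notin> M"
    proof
      assume "x \<in> M"
      then have "generate G (insert x M) \<subseteq> M"
        using M(1) by (intro generate_subgroup_incl) auto
      then show False
        using gen M subgroup.subset by blast
    qed
  next
    assume "x \<notin> M"
    then show "generate G (insert x M) = carrier G"
      using assms(1) sub incl unfolding maximal_subgroup_def by blast
  qed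
qed

lemma (in group) mr_equiv_subset_m_equiv:
  assumes "finite (carrier G)" "card (carrier G) < r"
  shows "mr_equiv r G \<subseteq> m_equiv G"
proof safe
  fix x y assume xy: "(x, y) \<in> mr_equiv r G"
  then have x: "x \<in> carrier G" and y: "y \<in> carrier G"
    by (auto simp: mr_equiv_def)
  have "x \<in> M \<longleftrightarrow> y \<in> M" if M: "maximal_subgroup M G" for M
  proof -
    have sub: "M \<subseteq> carrier G"
      using M by (auto simp: maximal_subgroup_def dest: subgroup.subset)
    \<comment> \<open>The threshold |G| < r makes all of \<open>M\<close> admissible as a test
      set.\<close>
    then have "finite M" "card M \<le> r - 1"
      using assms card_mono[OF assms(1) sub] by (auto intro: finite_subset)
    then show ?thesis
      using xy sub generate_insert_maximal_subgroup[OF M x] generate_insert_maximal_subgroup[OF M y]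
      unfolding mr_equiv_iff by blast
  qed
  with x y show "(x, y) \<in> m_equiv G"
    by (auto simp: m_equiv_def)
qed

theorem lemma2p4:
  fixes G :: "('a, 'b) monoid_scheme"
  assumes "group G" and "finite (carrier G)"
  shows "(\<forall>r s. 1 \<le> r \<and> r \<le> s \<longrightarrow> mr_equiv s G \<subseteq> mr_equiv r G)
    \<and> (\<not> trivial_group G \<longrightarrow>
         (1 \<le> min_num_gens G
          \<and> mr_equiv (min_num_gens G) G \<noteq> carrier G \<times> carrier G
          \<and> (\<forall>r. 1 \<le> r \<and> mr_equiv r G \<noteq> carrier G \<times> carrier G \<longrightarrow> min_num_gens G \<le> r))
         \<and> min_num_gens G + 1 \<le> card (carrier G // mr_equiv (min_num_gens G) G))
    \<and> (\<exists>r0\<ge>1. \<forall>r\<ge>r0. mr_equiv r G = m_equiv G)"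
proof -
  interpret group G by fact
  have "mr_equiv r G = m_equiv G" if "card (carrier G) + 1 \<le> r" for r
    using that mr_equiv_subset_m_equiv[of r] m_equiv_subset_mr_equiv[of r] assms(2) by auto
  then have "\<exists>r0\<ge>1. \<forall>r\<ge>r0. mr_equiv r G = m_equiv G"
    \<comment> \<open>This \<open>r0\<close> is the least value exceeding |G|; no sharper bound is
      sought.\<close>
    by (intro exI[of _ "card (carrier G) + 1"]) auto
  moreover have "min_num_gens G \<le> r"
    if "1 \<le> r" "mr_equiv r G \<noteq> carrier G \<times> carrier G" for r
    using that mr_equiv_universal[of r] by (meson not_le)
  ultimately show ?thesis
    using mr_equiv_antimono min_num_gens_pos mr_equiv_min_num_gens_not_universal
      card_classes_min_num_gens assms(2) by blast
qed

end
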